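(* For each type $\tau\in\{A',A,B,C,D\}$, the Casimir function $\kappa_N^\tau$ admits (for type $D$: on the sector $m=n=0$), as $N\to\infty$ with partition data fixed, an expansion $$\kappa_N^\tau=E^\tau+\frac1NL^\tau+O(N^{-2}),$$ where $E^\tau,L^\tau\in\mathcal A^\tau$ are polynomials in the shifted power sums $\mathbf p_1,\mathbf p_2$ (and in $n$ for type $A'$), independent of $N$. More precisely: - Type $A'$: the expansion is exact, $\kappa_N^{A'}=E^{A'}+\frac1NL^{A'}$, with $E^{A'}(\alpha,\beta,n)=\mathbf p_1(\alpha)+\mathbf p_1(\beta)+n^2$ and $L^{A'}(\alpha,\beta,n)=\mathbf p_2(\alpha)+\mathbf p_2(\beta)+2n(\mathbf p_1(\alpha)-\mathbf p_1(\beta))$. - Type $A$: the expansion is exact, $\kappa_N^A=E^A+\frac1NL^A+\frac1{N^2}Q^A$, with $E^A(\alpha,\beta)=\mathbf p_1(\alpha)+\mathbf p_1(\beta)$, $L^A(\alpha,\beta)=\mathbf p_2(\alpha)+\mathbf p_2(\beta)$, and $Q^A$ a polynomial in $\mathbf p_1(\alpha),\mathbf p_1(\beta)$ independent of $N$. - Types $B$ and $C$: $E^\tau(\mu)=\mathbf p_1(\mu)$, $L^B(\mu)=\mathbf p_2(\mu)-\mathbf p_1(\mu)$, $L^C(\mu)=\mathbf p_2(\mu)+\mathbf p_1(\mu)$. - Type $D$: the expansion holds on the sector $m=n=0$; for fixed $(\mu,m,n)$ outside this sector (so $m\ge1$), the Casimir contains a term of order $mN$ and does not admit a finite limit as $N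\to\infty$.
   Context: Partitions $\alpha=(\alpha_1\ge\dots\ge\alpha_{\ell(\alpha)}>0)$ have size $|\alpha|=\sum\alpha_i$ and total content $K(\alpha)=\frac12\sum_i\alpha_i(\alpha_i+1-2i)$; $\alpha_i=0$ for $i>\ell(\alpha)$. The shifted symmetric power sums used are $\mathbf p_k(\lambda)=\sum_{i\ge1}\big[(\lambda_i+\frac12-i)^k-(\frac12-i)^k\big]$ up to additive constants; here they are normalized so that $\mathbf p_1(\lambda)=|\lambda|$ and $\mathbf p_2(\lambda)=\sum_i\lambda_i(\lambda_i+1-2i)=2K(\lambda)$. $\Lambda^*=\mathbb C[\mathbf p_1,\mathbf p_2,\dots]$ is the algebra of shifted symmetric functions. Put $\mathcal A^{A'}=\Lambda^*\otimes\Lambda^*\otimes\mathbb C[n]$, $\mathcal A^A=\Lambda^*\otimes\Lambda^*$, and $\mathcal A^\tau=\Lambda^*$ for $\tau=B,C$ and for $\tau=D$ restricted to $m=n=0$. Here $N$ is the matrix size: the groups are $\mathrm U(N)$ ($A'$), $\mathrm{SU}(N)$ ($A$), $\mathrm{SO}(N)$ with $N=2r+1$ ($B$), $\mathrm{Sp}(r)$ with $N=2r$ ($C$), $\mathrm{SO}(N)$ with $N=2r$ ($D$). Casimir numbers of a highest weight $\lambda$ (eigenvalues of minus the Laplace–Beltrami operator on irreducible characters, in the normalization adopted): $A'$: $c_2(\lambda)=\frac1N\sum_{i=1}^N\lambda_i(\lambda_i+N+1-2i)$; $A$: $c_2(\lambda)=\frac1N\sum_{i=1}^N\lambda_i(\lambda_i+N+1-2i)-\frac1{N^2}(\sum_i\lambda_i)^2$;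 $B$ and $D$: $c_2(\lambda)=\frac1N\sum_{i=1}^r\lambda_i(\lambda_i+N-2i)$; $C$: $c_2(\lambda)=\frac1N\sum_{i=1}^r\lambda_i(\lambda_i+N+2-2i)$. Parametrization of highest weights, with $A_N=\lfloor(N+1)/2\rfloor-1$, $B_N=N-\lfloor(N+1)/2\rfloor$: $\lambda_N^{A'}(\alpha,\beta,n)=(\alpha_1+n,\dots,\alpha_{\ell(\alpha)}+n,n,\dots,n,n-\beta_{\ell(\beta)},\dots,n-\beta_1)\in\mathbb Z^N$ for partitions with $\ell(\alpha)\le A_N$, $\ell(\beta)\le B_N$, and $n\in\mathbb Z$; $\lambda_N^A(\alpha,\beta)=\lambda_N^{A'}(\alpha,\beta,\beta_1)$ for the same $\alpha,\beta$; $\lambda_N^B(\mu)=\lambda_N^C(\mu)=(\mu_1,\dots,\mu_{\ell(\mu)},0,\dots,0)\in\mathbb N^r$ for $\ell(\mu)\le r$; $\lambda_N^D(\mu,m,n)=(\mu_1+m,\dots,\mu_{r-2}+m,m,n)$ for $\ell(\mu)\le r-2$, $m\in\mathbb N$, $n\in\mathbb Z$, $|n|\le m$. $\kappa_N^\tau$ is the function $\kappa_N^\tau(\cdot)=c_2(\lambda_N^\tau(\cdot))$ on the corresponding parameter set (in type $D$, on the sector $m=n=0$: $\kappa_N^D(\mu)=c_2(\lambda_N^D(\mu,0,0))$). $O(N^{-2})$ is understood pointwise, for fixed partition data (with $N$ large enough that it is admissible). *)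

theory Defs
  imports Complex_Main "HOL-Library.Landau_Symbols" "HOL-Computational_Algebra.Polynomial"
begin

section \<open>Partitions and shifted power sums\<close>

typedef partition = "{xs :: nat list. sorted_wrt (\<ge>) xs \<and> 0 \<notin> set xs}"
  morphisms parts Partition
  by (rule exI[of _ "[]"]) simp

definition plen :: "partition \<Rightarrow> nat" where
  "plen \<alpha> = length (parts \<alpha>)"

text \<open>Parts are indexed from 1, with value 0 beyond the length.\<close>

definition part :: "partition \<Rightarrow> nat \<Rightarrow> nat" where
  "part \<alpha> i = (if 1 \<le> i \<and> i \<le> plen \<alpha> then parts \<alpha> ! (i - 1) else 0)"

definition psize :: "partition \<Rightarrow> nat" where
  "psize \<alpha> = (\<Sum>i=1..plen \<alpha>. part \<alpha> i)"

definition content :: "partition \<Rightarrow> real" where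
  "content \<alpha> = 1/2 * (\<Sum>i=1..plen \<alpha>. real (part \<alpha> i) * (real (part \<alpha> i) + 1 - 2 * real i))"

text \<open>The series over all \<open>i \<ge> 1\<close> is finite: its terms with \<open>i > plen \<mu>\<close> vanish.\<close>

definition shifted_power_sum :: "nat \<Rightarrow> partition \<Rightarrow> real" where
  "shifted_power_sum k \<mu> =
     (\<Sum>i=1..plen \<mu>. ((real (part \<mu> i) + 1/2 - real i) ^ k - (1/2 - real i) ^ k))"

lemma shifted_power_sum_1: "shifted_power_sum 1 \<mu> = real (psize \<mu>)"
  by (simp add: shifted_power_sum_def psize_def)

lemma shifted_power_sum_2: "shifted_power_sum 2 \<mu> = 2 * content \<mu>"
  by (simp add: shifted_power_sum_def content_def power2_eq_square algebra_simps
        flip: sum_distrib_left)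

abbreviation p\<^sub>1 :: "partition \<Rightarrow> complex" where
  "p\<^sub>1 \<mu> \<equiv> complex_of_real (shifted_power_sum 1 \<mu>)"

abbreviation p\<^sub>2 :: "partition \<Rightarrow> complex" where
  "p\<^sub>2 \<mu> \<equiv> complex_of_real (shifted_power_sum 2 \<mu>)"


section \<open>Algebras of functions\<close>

text \<open>
  The unital complex algebra of functions generated by \<open>G\<close>, that is, the functions
  that are polynomials with complex coefficients in the elements of \<open>G\<close>.
\<close>

inductive_set polys_in :: "('a \<Rightarrow> complex) set \<Rightarrow> ('a \<Rightarrow> complex) set"
  for G :: "('a \<Rightarrow> complex) set" where
  const: "(\<lambda>_. c) \<in> polys_in G"
| gen: "g \<in> G \<Longrightarrow> g \<in> polys_in G"
| add: "f \<in> polys_in G \<Longrightarrow> g \<in> polys_in G \<Longrightarrow> (\<lambda>x. f x + g x) \<in> polys_in G"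
| mult: "f \<in> polys_in G \<Longrightarrow> g \<in> polys_in G \<Longrightarrow> (\<lambda>x. f x * g x) \<in> polys_in G"

definition Lambda_star :: "(partition \<Rightarrow> complex) set" where
  "Lambda_star =
     polys_in {(\<lambda>\<mu>. complex_of_real (shifted_power_sum k \<mu>)) | k. k \<ge> 1}"

text \<open>
  The tensor product of two spaces of functions, identified as usual with a space of
  functions on the product (\<open>f \<otimes> g\<close> is the function sending \<open>(x, y)\<close> to \<open>f x * g y\<close>).
\<close>

definition fun_tensor ::
  "('a \<Rightarrow> complex) set \<Rightarrow> ('b \<Rightarrow> complex) set \<Rightarrow> ('a \<times> 'b \<Rightarrow> complex) set" where
  "fun_tensor F G =
     {(\<lambda>(x, y). \<Sum>i<k. f i x * g i y) | (k :: nat) f g. \<forall>i<k. f i \<in> F \<and> g i \<in> G}"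

definition int_polys :: "(int \<Rightarrow> complex) set" where
  "int_polys = range (\<lambda>q n. poly q (of_int n))"

definition alg_A' :: "(partition \<times> partition \<times> int \<Rightarrow> complex) set" where
  "alg_A' = fun_tensor Lambda_star (fun_tensor Lambda_star int_polys)"

definition alg_A :: "(partition \<times> partition \<Rightarrow> complex) set" where
  "alg_A = fun_tensor Lambda_star Lambda_star"


section \<open>Casimir numbers\<close>

text \<open>
  A highest weight is a list of integers, its \<open>i\<close>-th coordinate (\<open>i \<ge> 1\<close>) being
  \<open>w ! (i - 1)\<close>.  \<open>N\<close> is the matrix size; in types B, C, D the rank is \<open>r = N div 2\<close>.
\<close>

definition casimir_A' :: "nat \<Rightarrow> int list \<Rightarrow> real" where
  "casimir_A' N w = 1 / real N *
     (\<Sum>i=1..N. real_of_int (w ! (i - 1)) * (real_of_int (w ! (i - 1)) + real N + 1 - 2 * real i))"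

definition casimir_A :: "nat \<Rightarrow> int list \<Rightarrow> real" where
  "casimir_A N w = 1 / real N *
     (\<Sum>i=1..N. real_of_int (w ! (i - 1)) * (real_of_int (w ! (i - 1)) + real N + 1 - 2 * real i))
     - 1 / (real N)\<^sup>2 * (\<Sum>i=1..N. real_of_int (w ! (i - 1)))\<^sup>2"

definition casimir_BD :: "nat \<Rightarrow> int list \<Rightarrow> real" where
  "casimir_BD N w = 1 / real N *
     (\<Sum>i=1..N div 2. real_of_int (w ! (i - 1)) * (real_of_int (w ! (i - 1)) + real N - 2 * real i))"

definition casimir_C :: "nat \<Rightarrow> int list \<Rightarrow> real" where
  "casimir_C N w = 1 / real N *
     (\<Sum>i=1..N div 2. real_of_int (w ! (i - 1)) * (real_of_int (w ! (i - 1)) + real N + 2 - 2 * real i))"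


section \<open>Parametrization of highest weights\<close>

definition A_bound :: "nat \<Rightarrow> nat" where
  "A_bound N = (N + 1) div 2 - 1"

definition B_bound :: "nat \<Rightarrow> nat" where
  "B_bound N = N - (N + 1) div 2"

text \<open>
  The weights below are meaningful for admissible parameters only:
  \<open>plen \<alpha> \<le> A_bound N\<close> and \<open>plen \<beta> \<le> B_bound N\<close> in types A' and A,
  \<open>plen \<mu> \<le> r\<close> in types B and C, and \<open>2 \<le> r\<close>, \<open>plen \<mu> \<le> r - 2\<close>, \<open>\<bar>n\<bar> \<le> m\<close> in type D.
\<close>

definition weight_A' :: "nat \<Rightarrow> partition \<Rightarrow> partition \<Rightarrow> int \<Rightarrow> int list" where
  "weight_A' N \<alpha> \<beta> n =
     map (\<lambda>a. int a + n) (parts \<alpha>) @ replicate (N - plen \<alpha> - plen \<beta>) n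
       @ map (\<lambda>b. n - int b) (rev (parts \<beta>))"

definition weight_A :: "nat \<Rightarrow> partition \<Rightarrow> partition \<Rightarrow> int list" where
  "weight_A N \<alpha> \<beta> = weight_A' N \<alpha> \<beta> (int (part \<beta> 1))"

definition weight_BC :: "nat \<Rightarrow> partition \<Rightarrow> int list" where
  "weight_BC N \<mu> = map int (parts \<mu>) @ replicate (N div 2 - plen \<mu>) 0"

definition weight_D :: "nat \<Rightarrow> partition \<Rightarrow> nat \<Rightarrow> int \<Rightarrow> int list" where
  "weight_D N \<mu> m n = map (\<lambda>i. int (part \<mu> i) + int m) [1..<N div 2 - 1] @ [int m, n]"

definition kappa_A' :: "nat \<Rightarrow> partition \<Rightarrow> partition \<Rightarrow> int \<Rightarrow> real" where
  "kappa_A' N \<alpha> \<beta> n = casimir_A' N (weight_A' N \<alpha> \<beta> n)"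

definition kappa_A :: "nat \<Rightarrow> partition \<Rightarrow> partition \<Rightarrow> real" where
  "kappa_A N \<alpha> \<beta> = casimir_A N (weight_A N \<alpha> \<beta>)"

definition kappa_B :: "nat \<Rightarrow> partition \<Rightarrow> real" where
  "kappa_B N \<mu> = casimir_BD N (weight_BC N \<mu>)"

definition kappa_C :: "nat \<Rightarrow> partition \<Rightarrow> real" where
  "kappa_C N \<mu> = casimir_C N (weight_BC N \<mu>)"

definition kappa_D :: "nat \<Rightarrow> partition \<Rightarrow> nat \<Rightarrow> int \<Rightarrow> real" where
  "kappa_D N \<mu> m n = casimir_BD N (weight_D N \<mu> m n)"

end

theory Submission
  imports Defs
begin

section \<open>Sums over the parts of a partition, extended by zero parts\<close>

lemma part_eq_0 [simp]: "plen \<mu> < i \<Longrightarrow> part \<mu> i = 0"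
  by (simp add: part_def)

text \<open>Rests on (x + 1/2 - i)^2 - (1/2 - i)^2 = x (x + 1 - 2i). Every Casimir sum has summands
  of this shape up to a change of the shift, and \<open>c\<close> records that change: N in type A',
  N - 1 in type B, N + 1 in type C. The upper limit \<open>M\<close> is free because later parts are
  zero, so it can be N or the rank.\<close>

lemma sum_quadratic_parts:
  assumes "plen \<mu> \<le> M"
  shows "(\<Sum>i=1..M. real (part \<mu> i) * (real (part \<mu> i) + c + 1 - 2 * real i))
    = shifted_power_sum 2 \<mu> + c * shifted_power_sum 1 \<mu>"
proof -
  have "(\<Sum>i=1..M. real (part \<mu> i) * (real (part \<mu> i) + c + 1 - 2 * real i))
      = (\<Sum>i=1..plen \<mu>. real (part \<mu> i) * (real (part \<mu> i) + c + 1 - 2 * real i))"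
    using assms by (intro sum.mono_neutral_right) auto
  then show ?thesis
    by (simp add: shifted_power_sum_def sum_distrib_left power2_eq_square algebra_simps
        flip: sum.distrib)
qed

lemma sum_parts:
  assumes "plen \<mu> \<le> M"
  shows "(\<Sum>i=1..M. real (part \<mu> i)) = shifted_power_sum 1 \<mu>"
proof -
  have "(\<Sum>i=1..M. real (part \<mu> i)) = (\<Sum>i=1..plen \<mu>. real (part \<mu> i))"
    using assms by (intro sum.mono_neutral_right) auto
  then show ?thesis
    by (simp add: shifted_power_sum_def)
qed

lemma sum_1_rev:
  fixes f :: "nat \<Rightarrow> 'a::comm_monoid_add"
  shows "(\<Sum>i=1..N. f (N + 1 - i)) = (\<Sum>i=1..N. f i)"
  using sum.atLeastAtMost_rev[of f 1 N] by (simp add: add.commute)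


section \<open>Casimir numbers in types A' and A\<close>

text \<open>One formula covers all three blocks of the weight because \<open>part\<close> is 0
  beyond the length. The length hypothesis makes the middle block
  \<open>N - plen \<alpha> - plen \<beta>\<close> an untruncated difference, so the list has length
  N and the reversed block ends at position N.\<close>

lemma weight_A'_nth:
  assumes "plen \<alpha> + plen \<beta> \<le> N" "1 \<le> i" "i \<le> N"
  shows "weight_A' N \<alpha> \<beta> n ! (i - 1) = int (part \<alpha> i) - int (part \<beta> (N + 1 - i)) + n"
  using assms
  by (auto simp: weight_A'_def part_def plen_def nth_append rev_nth less_diff_conv)

lemma sum_weight_A':
  assumes "plen \<alpha> + plen \<beta> \<le> N"
  shows "(\<Sum>i=1..N. real_of_int (weight_A' N \<alpha> \<beta> n ! (i - 1)))
    = shifted_power_sum 1 \<alpha> - shifted_power_sum 1 \<beta> + real N * real_of_int n"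
proof -
  have "(\<Sum>i=1..N. real_of_int (weight_A' N \<alpha> \<beta> n ! (i - 1)))
      = (\<Sum>i=1..N. real (part \<alpha> i) - real (part \<beta> (N + 1 - i)) + real_of_int n)"
    by (intro sum.cong refl) (subst weight_A'_nth, use assms in auto)
  also have "\<dots> = (\<Sum>i=1..N. real (part \<alpha> i)) - (\<Sum>i=1..N. real (part \<beta> i)) + real N * real_of_int n"
    using sum_1_rev[of "\<lambda>i. real (part \<beta> i)" N] by (simp add: sum.distrib sum_subtractf)
  finally show ?thesis
    using sum_parts[of \<alpha> N] sum_parts[of \<beta> N] assms by simp
qed

text \<open>The cross terms vanish because \<open>\<alpha>\<close> and the reversed \<open>\<beta>\<close> have disjoint supports,
  and \<open>i \<mapsto> N + 1 - i\<close> changes the sign of \<open>N + 1 - 2i\<close>.\<close>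

lemma kappa_A'_eq:
  assumes "plen \<alpha> + plen \<beta> \<le> N" "N \<ge> 1"
  shows "kappa_A' N \<alpha> \<beta> n
    = shifted_power_sum 1 \<alpha> + shifted_power_sum 1 \<beta> + (real_of_int n)\<^sup>2
      + 1 / real N * (shifted_power_sum 2 \<alpha> + shifted_power_sum 2 \<beta>
          + 2 * real_of_int n * (shifted_power_sum 1 \<alpha> - shifted_power_sum 1 \<beta>))"
proof -
  define a where "a i = real (part \<alpha> i)" for i
  define b where "b i = real (part \<beta> i)" for i
  define d where "d i = real N + 1 - 2 * real i" for i
  define x where "x = real_of_int n"
  have d_rev: "d (N + 1 - i) = - d i" if "i \<in> {1..N}" for i
    using that by (auto simp: d_def of_nat_diff)
  have sum_d: "(\<Sum>i=1..N. d i) = 0"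
  proof -
    have "(\<Sum>i=1..N. d i) = (\<Sum>i=1..N. - d i)"
      unfolding sum_1_rev[of d N, symmetric] by (rule sum.cong) (use d_rev in auto)
    then show ?thesis by (simp add: sum_negf)
  qed
  \<comment> \<open>The \<beta> product is written with \<open>d (N + 1 - i)\<close> instead of
    \<open>- d i\<close>: it then depends on \<open>N + 1 - i\<close> alone, and
    \<open>sum_1_rev\<close> can undo the reversal.\<close>
  have "(\<Sum>i=1..N. real_of_int (weight_A' N \<alpha> \<beta> n ! (i - 1))
        * (real_of_int (weight_A' N \<alpha> \<beta> n ! (i - 1)) + real N + 1 - 2 * real i))
      = (\<Sum>i=1..N. a i * (a i + d i) + b (N + 1 - i) * (b (N + 1 - i) + d (N + 1 - i))
          + 2 * x * (a i - b (N + 1 - i)) + x\<^sup>2 + x * d i)"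
  proof (intro sum.cong refl)
    fix i assume i: "i \<in> {1..N}"
    have w: "real_of_int (weight_A' N \<alpha> \<beta> n ! (i - 1)) = a i - b (N + 1 - i) + x"
      using i assms by (subst weight_A'_nth) (auto simp: a_def b_def x_def)
    have "a i * b (N + 1 - i) = 0"
    proof (cases "i \<le> plen \<alpha>")
      case True
      then have "plen \<beta> < N + 1 - i" using assms by linarith
      then show ?thesis by (simp add: b_def)
    qed (simp add: a_def)
    \<comment> \<open>With \<open>b'\<close> in place of the reversed part, \<open>a i * b'\<close>
      is the only product of parts of both partitions.\<close>
    moreover have "(a i - b' + x) * (a i - b' + x + d i)
        = a i * (a i + d i) + b' * (b' - d i) + 2 * x * (a i - b') + x\<^sup>2 + x * d i - 2 * (a i * b')"
      for b' by (simp add: algebra_simps power2_eq_square)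
    ultimately have "(a i - b (N + 1 - i) + x) * (a i - b (N + 1 - i) + x + d i)
        = a i * (a i + d i) + b (N + 1 - i) * (b (N + 1 - i) - d i)
          + 2 * x * (a i - b (N + 1 - i)) + x\<^sup>2 + x * d i"
      by simp
    then show "real_of_int (weight_A' N \<alpha> \<beta> n ! (i - 1))
        * (real_of_int (weight_A' N \<alpha> \<beta> n ! (i - 1)) + real N + 1 - 2 * real i)
      = a i * (a i + d i) + b (N + 1 - i) * (b (N + 1 - i) + d (N + 1 - i))
          + 2 * x * (a i - b (N + 1 - i)) + x\<^sup>2 + x * d i"
      unfolding w d_rev[OF i] by (simp add: d_def add_diff_eq add.assoc)
  qed
  also have "\<dots> = (\<Sum>i=1..N. a i * (a i + d i)) + (\<Sum>i=1..N. b (N + 1 - i) * (b (N + 1 - i) + d (N + 1 - i)))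
      + 2 * x * ((\<Sum>i=1..N. a i) - (\<Sum>i=1..N. b (N + 1 - i))) + real N * x\<^sup>2 + x * (\<Sum>i=1..N. d i)"
    by (simp add: sum.distrib sum_subtractf flip: sum_distrib_left)
  also have "\<dots> = (\<Sum>i=1..N. a i * (a i + d i)) + (\<Sum>i=1..N. b i * (b i + d i))
      + 2 * x * ((\<Sum>i=1..N. a i) - (\<Sum>i=1..N. b i)) + real N * x\<^sup>2"
    unfolding sum_d sum_1_rev[of b] sum_1_rev[of "\<lambda>i. b i * (b i + d i)"] by simp
  also have "\<dots> = shifted_power_sum 2 \<alpha> + real N * shifted_power_sum 1 \<alpha>
      + (shifted_power_sum 2 \<beta> + real N * shifted_power_sum 1 \<beta>)
      + 2 * x * (shifted_power_sum 1 \<alpha> - shifted_power_sum 1 \<beta>) + real N * x\<^sup>2"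
    using sum_quadratic_parts[of \<alpha> N "real N"] sum_quadratic_parts[of \<beta> N "real N"]
      sum_parts[of \<alpha> N] sum_parts[of \<beta> N] assms
    by (simp add: a_def b_def d_def add_diff_eq add.assoc)
  finally show ?thesis
    using assms by (simp add: kappa_A'_def casimir_A'_def x_def field_simps)
qed

text \<open>Type A subtracts the square of S/N, where S/N = n + (\<open>p\<^sub>1 \<alpha>\<close> -
  \<open>p\<^sub>1 \<beta>\<close>)/N is the mean of the coordinates. Its n^2 and its cross term
  cancel all n-dependence of \<open>kappa_A'_eq\<close>, so the choice n = \<beta>_1 leaves no
  trace; the rest of the square is the N^-2 term.\<close>

lemma kappa_A_eq:
  assumes "plen \<alpha> + plen \<beta> \<le> N" "N \<ge> 1"
  shows "kappa_A N \<alpha> \<beta>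
    = shifted_power_sum 1 \<alpha> + shifted_power_sum 1 \<beta>
      + 1 / real N * (shifted_power_sum 2 \<alpha> + shifted_power_sum 2 \<beta>)
      + 1 / (real N)\<^sup>2 * (- (shifted_power_sum 1 \<alpha> - shifted_power_sum 1 \<beta>)\<^sup>2)"
proof -
  have "kappa_A N \<alpha> \<beta> = kappa_A' N \<alpha> \<beta> (int (part \<beta> 1))
      - 1 / (real N)\<^sup>2 * (\<Sum>i=1..N. real_of_int (weight_A' N \<alpha> \<beta> (int (part \<beta> 1)) ! (i - 1)))\<^sup>2"
    by (simp add: kappa_A_def casimir_A_def kappa_A'_def casimir_A'_def weight_A_def)
  then show ?thesis
    using assms unfolding kappa_A'_eq[OF assms] sum_weight_A'[OF assms(1)]
    by (simp add: field_simps power2_eq_square)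
qed


section \<open>Casimir numbers in types B, C and D\<close>

lemma weight_BC_nth:
  assumes "plen \<mu> \<le> N div 2" "1 \<le> i" "i \<le> N div 2"
  shows "weight_BC N \<mu> ! (i - 1) = int (part \<mu> i)"
  using assms by (auto simp: weight_BC_def part_def plen_def nth_append)

text \<open>The shift N - 2i equals (N - 1) + 1 - 2i, so \<open>sum_quadratic_parts\<close> applies
  with c = N - 1. The -1 in c, divided by N, is the origin of -\<open>p\<^sub>1 \<mu>\<close> in the
  second coefficient; type C has c = N + 1 and the opposite sign.\<close>

lemma kappa_B_eq:
  assumes "plen \<mu> \<le> N div 2" "N \<ge> 1"
  shows "kappa_B N \<mu> = shifted_power_sum 1 \<mu>
    + 1 / real N * (shifted_power_sum 2 \<mu> - shifted_power_sum 1 \<mu>)"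
proof -
  have "(\<Sum>i=1..N div 2. real_of_int (weight_BC N \<mu> ! (i - 1))
        * (real_of_int (weight_BC N \<mu> ! (i - 1)) + real N - 2 * real i))
      = (\<Sum>i=1..N div 2. real (part \<mu> i) * (real (part \<mu> i) + (real N - 1) + 1 - 2 * real i))"
    by (intro sum.cong refl) (subst (1 2) weight_BC_nth, use assms in auto)
  then show ?thesis
    using assms sum_quadratic_parts[of \<mu> "N div 2" "real N - 1"]
    by (simp add: kappa_B_def casimir_BD_def field_simps)
qed

lemma kappa_C_eq:
  assumes "plen \<mu> \<le> N div 2" "N \<ge> 1"
  shows "kappa_C N \<mu> = shifted_power_sum 1 \<mu>
    + 1 / real N * (shifted_power_sum 2 \<mu> + shifted_power_sum 1 \<mu>)"
proof -
  have "(\<Sum>i=1..N div 2. real_of_int (weight_BC N \<mu> ! (i - 1))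
        * (real_of_int (weight_BC N \<mu> ! (i - 1)) + real N + 2 - 2 * real i))
      = (\<Sum>i=1..N div 2. real (part \<mu> i) * (real (part \<mu> i) + (real N + 1) + 1 - 2 * real i))"
    by (intro sum.cong refl) (subst (1 2) weight_BC_nth, use assms in auto)
  then show ?thesis
    using assms sum_quadratic_parts[of \<mu> "N div 2" "real N + 1"]
    by (simp add: kappa_C_def casimir_C_def field_simps)
qed

text \<open>Expanding (\<mu>_i + m)(\<mu>_i + m + 2r - 2i) gives a quadratic in \<mu>_i with shift
  enlarged by 2m, plus m^2 + 2m(r - i). Summed over i < r, the last term is m r (r - 1); dividing by
  N = 2r turns it into mN/4 - m/2, the source of the linear growth.\<close>

lemma kappa_D_eq:
  assumes "plen \<mu> + 2 \<le> r"
  shows "kappa_D (2 * r) \<mu> m n = shifted_power_sum 1 \<mu> + (real m)\<^sup>2 / 2 - real m / 2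
    + 1 / 4 * real m * real (2 * r)
    + 1 / real (2 * r) * (shifted_power_sum 2 \<mu> + (2 * real m - 1) * shifted_power_sum 1 \<mu>
        + (real_of_int n)\<^sup>2 - (real m)\<^sup>2)"
proof -
  \<comment> \<open>The first r - 1 coordinates all have the form \<mu>_i + m: the penultimate one,
    m itself, fits because \<mu>_(r-1) = 0.\<close>
  define s where "s = r - 1"
  have r: "r = Suc s" and s: "plen \<mu> < s"
    using assms by (auto simp: s_def)
  have w: "weight_D (2 * r) \<mu> m n ! (i - 1) = int (part \<mu> i) + int m" if "i \<in> {1..s}" for i
    using that s by (cases "i = s") (auto simp: weight_D_def nth_append r)
  \<comment> \<open>The last coordinate sits at i = r, where the shift 2r - 2i vanishes, so it
    contributes just n^2.\<close>
  have wr: "weight_D (2 * r) \<mu> m n ! s = n"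
    using s by (auto simp: weight_D_def nth_append r nth_Cons')
  have lin: "(\<Sum>i=1..s. 2 * (real r - real i)) = real s * real r"
  proof -
    \<comment> \<open>Here \<open>k\<close> and \<open>c\<close> are independent, since r = s + 1
      would otherwise change along the induction.\<close>
    have "(\<Sum>i=1..k. 2 * (c - real i)) = real k * (2 * c - real k - 1)" for k :: nat and c :: real
      by (induction k) (simp_all add: algebra_simps)
    from this[where k = s and c = "real r"] show ?thesis by (simp add: r algebra_simps)
  qed
  have "(\<Sum>i=1..s. real_of_int (weight_D (2 * r) \<mu> m n ! (i - 1))
        * (real_of_int (weight_D (2 * r) \<mu> m n ! (i - 1)) + real (2 * r) - 2 * real i))
      = (\<Sum>i=1..s. real (part \<mu> i) * (real (part \<mu> i) + (2 * real r + 2 * real m - 1) + 1 - 2 * real i)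
          + (real m)\<^sup>2 + real m * (2 * (real r - real i)))"
    by (intro sum.cong refl) (subst (1 2) w, auto simp: algebra_simps power2_eq_square)
  also have "\<dots> = shifted_power_sum 2 \<mu> + (2 * real r + 2 * real m - 1) * shifted_power_sum 1 \<mu>
      + real s * (real m)\<^sup>2 + real m * (real s * real r)"
    unfolding sum.distrib lin[symmetric] sum_distrib_left[of "real m"]
    using sum_quadratic_parts[of \<mu> s "2 * real r + 2 * real m - 1"] s by simp
  finally have "kappa_D (2 * r) \<mu> m n = 1 / real (2 * r) * (shifted_power_sum 2 \<mu>
      + (2 * real r + 2 * real m - 1) * shifted_power_sum 1 \<mu>
      + real s * (real m)\<^sup>2 + real m * (real s * real r) + (real_of_int n)\<^sup>2)"
    using wr by (simp add: kappa_D_def casimir_BD_def r power2_eq_square)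
  moreover have "real s = real r - 1" "real r > 0"
    by (simp_all add: r)
  ultimately show ?thesis
    by (simp add: field_simps power2_eq_square)
qed

text \<open>Outside the sector m is positive, since m = 0 forces n = 0. By \<open>kappa_D_eq\<close>
  the Casimir differs from mN/4 by A + B/N for large r, which stays bounded while mN/4 does
  not.\<close>

lemma kappa_D_unbounded:
  assumes "\<bar>n\<bar> \<le> int m" "(m, n) \<noteq> (0, 0)"
  shows "m \<ge> 1"
    and "(\<lambda>r. kappa_D (2 * r) \<mu> m n - 1 / 4 * real m * real (2 * r)) \<in> O(\<lambda>_. 1)"
    and "\<not> convergent (\<lambda>r. kappa_D (2 * r) \<mu> m n)"
proof -
  show m: "m \<ge> 1"
    using assms by (cases m) auto
  define A where "A = shifted_power_sum 1 \<mu> + (real m)\<^sup>2 / 2 - real m / 2"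
  define B where "B = shifted_power_sum 2 \<mu> + (2 * real m - 1) * shifted_power_sum 1 \<mu>
    + (real_of_int n)\<^sup>2 - (real m)\<^sup>2"
  have D: "kappa_D (2 * r) \<mu> m n - 1 / 4 * real m * real (2 * r) = A + 1 / real (2 * r) * B"
    if "plen \<mu> + 2 \<le> r" for r
    using kappa_D_eq[OF that, of m n] unfolding A_def B_def by linarith
  have ev: "\<forall>\<^sub>F r in sequentially. kappa_D (2 * r) \<mu> m n - 1 / 4 * real m * real (2 * r)
      = A + 1 / real (2 * r) * B"
    using eventually_ge_at_top[of "plen \<mu> + 2"] by eventually_elim (rule D)
  have "\<forall>\<^sub>F r in sequentially. norm (kappa_D (2 * r) \<mu> m n - 1 / 4 * real m * real (2 * r))
      \<le> (\<bar>A\<bar> + \<bar>B\<bar>) * norm (1::real)"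
    using ev eventually_ge_at_top[of 1]
  proof eventually_elim
    case (elim r)
    have "\<bar>1 / real (2 * r) * B\<bar> \<le> \<bar>B\<bar>"
      using elim(2) by (simp add: abs_mult field_simps mult_le_cancel_left1)
    with abs_triangle_ineq[of A "1 / real (2 * r) * B"] show ?case
      unfolding elim(1) by simp
  qed
  then show O: "(\<lambda>r. kappa_D (2 * r) \<mu> m n - 1 / 4 * real m * real (2 * r)) \<in> O(\<lambda>_. 1)"
    by (rule bigoI)
  show "\<not> convergent (\<lambda>r. kappa_D (2 * r) \<mu> m n)"
  proof
    assume "convergent (\<lambda>r. kappa_D (2 * r) \<mu> m n)"
    then obtain K where K: "\<And>r. \<bar>kappa_D (2 * r) \<mu> m n\<bar> \<le> K"
      using convergent_imp_Bseq[THEN BseqE] by (metis real_norm_def)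
    \<comment> \<open>The sequence is evaluated at index \<open>2 * r\<close>, that is N = 4r, where
      mN/4 is exactly m r and hence at least r. This exceeds the bound \<open>K\<close> plus the
      largest possible remainder; the summand \<open>plen \<mu> + 2\<close> makes \<open>D\<close>
      applicable.\<close>
    obtain r :: nat where r: "real r > K + \<bar>A\<bar> + \<bar>B\<bar> + real (plen \<mu>) + 2"
      using reals_Archimedean2 by blast
    moreover have "K \<ge> 0" using K[of 0] by linarith
    ultimately have "plen \<mu> + 2 \<le> r" "r \<ge> 1" by linarith+
    have "\<bar>1 / real (4 * r) * B\<bar> \<le> \<bar>B\<bar>"
      using \<open>r \<ge> 1\<close> by (simp add: abs_mult field_simps mult_le_cancel_left1)
    moreover have "kappa_D (2 * (2 * r)) \<mu> m n - real m * real r = A + 1 / real (4 * r) * B"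
      using D[of "2 * r"] \<open>plen \<mu> + 2 \<le> r\<close> by simp
    moreover have "real m * real r \<ge> real r"
      using m by (simp add: mult_le_cancel_right1)
    ultimately show False
      using K[of "2 * r"] r \<open>K \<ge> 0\<close> by linarith
  qed
qed


section \<open>Membership in the function algebras\<close>

lemma polys_in_power: "f \<in> polys_in G \<Longrightarrow> (\<lambda>x. f x ^ k) \<in> polys_in G"
  by (induction k) (auto intro: polys_in.intros)

lemma polys_in_diff:
  assumes "f \<in> polys_in G" "g \<in> polys_in G"
  shows "(\<lambda>x. f x - g x) \<in> polys_in G"
  using polys_in.add[OF assms(1) polys_in.mult[OF polys_in.const[of "-1"] assms(2)]] by simp

lemma fun_tensor_prod:
  assumes "f \<in> F" "g \<in> G"
  shows "(\<lambda>(x, y). f x * g y) \<in> fun_tensor F G"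
  unfolding fun_tensor_def
  by (rule CollectI, rule exI[of _ 1], rule exI[of _ "\<lambda>_. f"], rule exI[of _ "\<lambda>_. g"])
    (use assms in simp)

text \<open>Two finite sums of simple tensors are concatenated: \<open>u\<close> and
  \<open>v\<close> list the factors of the first sum and then those of the second.\<close>

lemma fun_tensor_add:
  assumes "h \<in> fun_tensor F G" "h' \<in> fun_tensor F G"
  shows "(\<lambda>x. h x + h' x) \<in> fun_tensor F G"
proof -
  obtain k :: nat and f g where h: "h = (\<lambda>(x, y). \<Sum>i<k. f i x * g i y)" "\<forall>i<k. f i \<in> F \<and> g i \<in> G"
    using assms(1) unfolding fun_tensor_def by blast
  obtain k' :: nat and f' g' where h': "h' = (\<lambda>(x, y). \<Sum>i<k'. f' i x * g' i y)"
      "\<forall>i<k'. f' i \<in> F \<and> g' i \<in> G"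
    using assms(2) unfolding fun_tensor_def by blast
  define u where "u i = (if i < k then f i else f' (i - k))" for i :: nat
  define v where "v i = (if i < k then g i else g' (i - k))" for i :: nat
  have "(\<Sum>i<k. f i x * g i y) + (\<Sum>i<k'. f' i x * g' i y) = (\<Sum>i<k + k'. u i x * v i y)" for x y
  proof -
    \<comment> \<open>Induction on the number \<open>m\<close> of terms taken from the second sum,
      with the first sum complete.\<close>
    have "(\<Sum>i<k + m. u i x * v i y) = (\<Sum>i<k. f i x * g i y) + (\<Sum>i<m. f' i x * g' i y)" for m
      by (induction m) (simp_all add: u_def v_def add.assoc)
    then show ?thesis by simp
  qed
  then have "(\<lambda>x. h x + h' x) = (\<lambda>(x, y). \<Sum>i<k + k'. u i x * v i y)"
    by (simp add: h(1) h'(1) fun_eq_iff)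
  moreover have "\<forall>i<k + k'. u i \<in> F \<and> v i \<in> G"
    using h(2) h'(2) by (auto simp: u_def v_def)
  ultimately show ?thesis
    unfolding fun_tensor_def mem_Collect_eq by (intro exI conjI)
qed

lemma Lambda_star_power_sum:
  "k \<ge> 1 \<Longrightarrow> (\<lambda>\<mu>. complex_of_real (shifted_power_sum k \<mu>)) \<in> Lambda_star"
  unfolding Lambda_star_def by (intro polys_in.gen) blast

lemma Lambda_star_const: "(\<lambda>_. c) \<in> Lambda_star"
  unfolding Lambda_star_def by (rule polys_in.const)

lemma Lambda_star_add: "f \<in> Lambda_star \<Longrightarrow> g \<in> Lambda_star \<Longrightarrow> (\<lambda>\<mu>. f \<mu> + g \<mu>) \<in> Lambda_star"
  unfolding Lambda_star_def by (rule polys_in.add)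

lemma Lambda_star_diff: "f \<in> Lambda_star \<Longrightarrow> g \<in> Lambda_star \<Longrightarrow> (\<lambda>\<mu>. f \<mu> - g \<mu>) \<in> Lambda_star"
  unfolding Lambda_star_def by (rule polys_in_diff)

lemma int_polys_poly: "(\<lambda>n. poly q (of_int n)) \<in> int_polys"
  unfolding int_polys_def by blast

text \<open>The function is f \<otimes> 1 + 1 \<otimes> g, and constants belong to
  \<open>Lambda_star\<close>.\<close>

lemma fun_tensor_Lambda_star:
  assumes "f \<in> Lambda_star" "g \<in> Lambda_star"
  shows "(\<lambda>(\<alpha>, \<beta>). f \<alpha> + g \<beta>) \<in> alg_A"
  using fun_tensor_add[OF fun_tensor_prod[OF assms(1) Lambda_star_const[of 1]]
      fun_tensor_prod[OF Lambda_star_const[of 1] assms(2)]]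
  by (simp add: alg_A_def case_prod_unfold)

lemma alg_A'_monomial:
  assumes "f \<in> Lambda_star" "g \<in> Lambda_star"
  shows "(\<lambda>(\<alpha>, \<beta>, n). f \<alpha> * (g \<beta> * poly q (of_int n))) \<in> alg_A'"
  using fun_tensor_prod[OF assms(1) fun_tensor_prod[OF assms(2) int_polys_poly[of q]]]
  by (simp add: alg_A'_def case_prod_unfold)

lemma alg_A'_add: "f \<in> alg_A' \<Longrightarrow> g \<in> alg_A' \<Longrightarrow> (\<lambda>x. f x + g x) \<in> alg_A'"
  unfolding alg_A'_def by (rule fun_tensor_add)

lemma E_in_alg_A': "(\<lambda>(\<alpha>, \<beta>, n). p\<^sub>1 \<alpha> + p\<^sub>1 \<beta> + (of_int n)\<^sup>2) \<in> alg_A'"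
proof -
  note p = Lambda_star_power_sum[of 1, simplified]
  note c = Lambda_star_const[of 1]
  show ?thesis
    \<comment> \<open>Three simple tensors, one per summand; \<open>[:0, 0, 1:]\<close> is the
      polynomial n^2.\<close>
    using alg_A'_add[OF alg_A'_add[OF alg_A'_monomial[OF p c, of 1] alg_A'_monomial[OF c p, of 1]]
        alg_A'_monomial[OF c c, of "[:0, 0, 1:]"]]
    by (simp add: case_prod_unfold power2_eq_square)
qed

lemma L_in_alg_A':
  "(\<lambda>(\<alpha>, \<beta>, n). p\<^sub>2 \<alpha> + p\<^sub>2 \<beta> + 2 * of_int n * (p\<^sub>1 \<alpha> - p\<^sub>1 \<beta>)) \<in> alg_A'"
proof -
  note p = Lambda_star_power_sum[of 1, simplified]
  note q = Lambda_star_power_sum[of 2, simplified]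
  note c = Lambda_star_const[of 1]
  show ?thesis
    \<comment> \<open>The mixed term splits into two simple tensors with polynomial factors 2n and
      -2n; the sign sits in the polynomial, so that closure under sums suffices.\<close>
    using alg_A'_add[OF alg_A'_add[OF alg_A'_monomial[OF q c, of 1] alg_A'_monomial[OF c q, of 1]]
        alg_A'_add[OF alg_A'_monomial[OF p c, of "[:0, 2:]"] alg_A'_monomial[OF c p, of "[:0, -2:]"]]]
    by (simp add: case_prod_unfold algebra_simps)
qed


section \<open>Expansions\<close>

text \<open>Passes from the exact formulas, valid once N is large enough for the partition data, to
  the O(N^-2) statements. The constant \<open>c\<close> is the coefficient of N^-2: zero except in
  type A, where it is the value of Q.\<close>

lemma eventually_eq_imp_bigo:
  fixes f g :: "'a \<Rightarrow> complex"
  assumes "\<forall>\<^sub>F x in F. f x = g x + c * h x"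
  shows "(\<lambda>x. f x - g x) \<in> O[F](h)"
  by (rule bigoI[of _ "norm c"], use assms in eventually_elim) (simp add: norm_mult)

lemma expansion_A':
  assumes "N \<ge> 1" "plen \<alpha> + plen \<beta> \<le> N"
  shows "complex_of_real (kappa_A' N \<alpha> \<beta> n) = p\<^sub>1 \<alpha> + p\<^sub>1 \<beta> + (of_int n)\<^sup>2
    + 1 / of_nat N * (p\<^sub>2 \<alpha> + p\<^sub>2 \<beta> + 2 * of_int n * (p\<^sub>1 \<alpha> - p\<^sub>1 \<beta>))"
  unfolding kappa_A'_eq[OF assms(2,1)] by simp

lemma expansion_A:
  assumes "N \<ge> 1" "plen \<alpha> + plen \<beta> \<le> N"
  shows "complex_of_real (kappa_A N \<alpha> \<beta>) = p\<^sub>1 \<alpha> + p\<^sub>1 \<beta> + 1 / of_nat N * (p\<^sub>2 \<alpha> + p\<^sub>2 \<beta>)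
    + 1 / (of_nat N)\<^sup>2 * (- (p\<^sub>1 \<alpha> - p\<^sub>1 \<beta>)\<^sup>2)"
  unfolding kappa_A_eq[OF assms(2,1)] by simp

text \<open>For N at least 1 the two bounds add up to N - 1.\<close>

lemma bounds_imp_length_le:
  "N \<ge> 1 \<Longrightarrow> a \<le> A_bound N \<Longrightarrow> b \<le> B_bound N \<Longrightarrow> a + b \<le> N"
  unfolding A_bound_def B_bound_def by linarith

lemma bigo_A':
  "(\<lambda>N. complex_of_real (kappa_A' N \<alpha> \<beta> n) - (p\<^sub>1 \<alpha> + p\<^sub>1 \<beta> + (of_int n)\<^sup>2
    + 1 / of_nat N * (p\<^sub>2 \<alpha> + p\<^sub>2 \<beta> + 2 * of_int n * (p\<^sub>1 \<alpha> - p\<^sub>1 \<beta>)))) \<in> O(\<lambda>N. 1 / (of_nat N)\<^sup>2)"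
  by (rule eventually_eq_imp_bigo[of _ _ 0],
      use eventually_ge_at_top[of "plen \<alpha> + plen \<beta> + 1"] in eventually_elim)
    (subst expansion_A', auto)

lemma bigo_A:
  "(\<lambda>N. complex_of_real (kappa_A N \<alpha> \<beta>) - (p\<^sub>1 \<alpha> + p\<^sub>1 \<beta> + 1 / of_nat N * (p\<^sub>2 \<alpha> + p\<^sub>2 \<beta>)))
    \<in> O(\<lambda>N. 1 / (of_nat N)\<^sup>2)"
  by (rule eventually_eq_imp_bigo[of _ _ "- (p\<^sub>1 \<alpha> - p\<^sub>1 \<beta>)\<^sup>2"],
      use eventually_ge_at_top[of "plen \<alpha> + plen \<beta> + 1"] in eventually_elim)
    (subst expansion_A, auto)

lemma bigo_B:
  "(\<lambda>r. complex_of_real (kappa_B (2 * r + 1) \<mu>) - (p\<^sub>1 \<mu> + 1 / of_nat (2 * r + 1) * (p\<^sub>2 \<mu> - p\<^sub>1 \<mu>)))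
    \<in> O(\<lambda>r. 1 / (of_nat (2 * r + 1))\<^sup>2)"
  by (rule eventually_eq_imp_bigo[of _ _ 0],
      use eventually_ge_at_top[of "plen \<mu>"] in eventually_elim)
    (subst kappa_B_eq, auto)

lemma bigo_C:
  "(\<lambda>r. complex_of_real (kappa_C (2 * r) \<mu>) - (p\<^sub>1 \<mu> + 1 / of_nat (2 * r) * (p\<^sub>2 \<mu> + p\<^sub>1 \<mu>)))
    \<in> O(\<lambda>r. 1 / (of_nat (2 * r))\<^sup>2)"
  by (rule eventually_eq_imp_bigo[of _ _ 0],
      use eventually_ge_at_top[of "plen \<mu> + 1"] in eventually_elim)
    (subst kappa_C_eq, auto)

text \<open>At m = n = 0 the formula of \<open>kappa_D_eq\<close> collapses to that of type B, so
  both types share the same coefficients. The threshold is the admissibility condition on the length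
  of \<mu>.\<close>

lemma bigo_D:
  "(\<lambda>r. complex_of_real (kappa_D (2 * r) \<mu> 0 0) - (p\<^sub>1 \<mu> + 1 / of_nat (2 * r) * (p\<^sub>2 \<mu> - p\<^sub>1 \<mu>)))
    \<in> O(\<lambda>r. 1 / (of_nat (2 * r))\<^sup>2)"
  by (rule eventually_eq_imp_bigo[of _ _ 0],
      use eventually_ge_at_top[of "plen \<mu> + 2"] in eventually_elim)
    (subst kappa_D_eq, auto)

section \<open>Polynomiality of the coefficients in the power sums\<close>

lemma polys_in_A':
  fixes G :: "(partition \<times> partition \<times> int \<Rightarrow> complex) set"
  assumes "G = {\<lambda>(\<alpha>, \<beta>, n). p\<^sub>1 \<alpha>, \<lambda>(\<alpha>, \<beta>, n). p\<^sub>2 \<alpha>, \<lambda>(\<alpha>, \<beta>, n). p\<^sub>1 \<beta>,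
    \<lambda>(\<alpha>, \<beta>, n). p\<^sub>2 \<beta>, \<lambda>(\<alpha>, \<beta>, n). of_int n}"
  shows "(\<lambda>(\<alpha>, \<beta>, n). p\<^sub>1 \<alpha> + p\<^sub>1 \<beta> + (of_int n)\<^sup>2) \<in> polys_in G"
    and "(\<lambda>(\<alpha>, \<beta>, n). p\<^sub>2 \<alpha> + p\<^sub>2 \<beta> + 2 * of_int n * (p\<^sub>1 \<alpha> - p\<^sub>1 \<beta>)) \<in> polys_in G"
  unfolding assms case_prod_unfold
  by (intro polys_in.add polys_in.mult polys_in_power polys_in_diff polys_in.const;
      rule polys_in.gen; simp)+

lemma polys_in_A:
  "(\<lambda>(\<alpha>, \<beta>). p\<^sub>1 \<alpha> + p\<^sub>1 \<beta>) \<in> polys_in {\<lambda>(\<alpha>, \<beta>). p\<^sub>1 \<alpha>, \<lambda>(\<alpha>, \<beta>). p\<^sub>2 \<alpha>,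
    \<lambda>(\<alpha>, \<beta>). p\<^sub>1 \<beta>, \<lambda>(\<alpha>, \<beta>). p\<^sub>2 \<beta>}"
  "(\<lambda>(\<alpha>, \<beta>). p\<^sub>2 \<alpha> + p\<^sub>2 \<beta>) \<in> polys_in {\<lambda>(\<alpha>, \<beta>). p\<^sub>1 \<alpha>, \<lambda>(\<alpha>, \<beta>). p\<^sub>2 \<alpha>,
    \<lambda>(\<alpha>, \<beta>). p\<^sub>1 \<beta>, \<lambda>(\<alpha>, \<beta>). p\<^sub>2 \<beta>}"
  unfolding case_prod_unfold by (intro polys_in.add; rule polys_in.gen; simp)+

lemma Q_polys_in:
  "(\<lambda>(\<alpha>, \<beta>). - (p\<^sub>1 \<alpha> - p\<^sub>1 \<beta>)\<^sup>2) \<in> polys_in {\<lambda>(\<alpha>, \<beta>). p\<^sub>1 \<alpha>, \<lambda>(\<alpha>, \<beta>). p\<^sub>1 \<beta>}"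
proof -
  \<comment> \<open>The negative is written as a difference from the constant 0 to match
    \<open>polys_in_diff\<close>.\<close>
  have "(\<lambda>x. 0 - (p\<^sub>1 (fst x) - p\<^sub>1 (snd x))\<^sup>2) \<in> polys_in {\<lambda>x. p\<^sub>1 (fst x), \<lambda>x. p\<^sub>1 (snd x)}"
    by (intro polys_in_power polys_in_diff polys_in.const; rule polys_in.gen; simp)
  then show ?thesis
    by (simp add: case_prod_unfold)
qed

lemma polys_in_power_sums:
  "(\<lambda>\<mu>. p\<^sub>2 \<mu> - p\<^sub>1 \<mu>) \<in> polys_in {p\<^sub>1, p\<^sub>2}"
  "(\<lambda>\<mu>. p\<^sub>2 \<mu> + p\<^sub>1 \<mu>) \<in> polys_in {p\<^sub>1, p\<^sub>2}"
  "p\<^sub>1 \<in> polys_in {p\<^sub>1, p\<^sub>2}"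
  by (intro polys_in.add polys_in_diff; rule polys_in.gen; simp)+ (rule polys_in.gen, simp)

theorem proposition2p8:
  "(\<exists>E L. E \<in> alg_A' \<and> L \<in> alg_A'
       \<and> {E, L} \<subseteq> polys_in {\<lambda>(\<alpha>, \<beta>, n). p\<^sub>1 \<alpha>, \<lambda>(\<alpha>, \<beta>, n). p\<^sub>2 \<alpha>,
                            \<lambda>(\<alpha>, \<beta>, n). p\<^sub>1 \<beta>, \<lambda>(\<alpha>, \<beta>, n). p\<^sub>2 \<beta>,
                            \<lambda>(\<alpha>, \<beta>, n). of_int n}
       \<and> (\<forall>\<alpha> \<beta> n. E (\<alpha>, \<beta>, n) = p\<^sub>1 \<alpha> + p\<^sub>1 \<beta> + (of_int n)\<^sup>2)
       \<and> (\<forall>\<alpha> \<beta> n. L (\<alpha>, \<beta>, n) = p\<^sub>2 \<alpha> + p\<^sub>2 \<beta> + 2 * of_int n * (p\<^sub>1 \<alpha> - p\<^sub>1 \<beta>))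
       \<and> (\<forall>\<alpha> \<beta> n. (\<lambda>N. complex_of_real (kappa_A' N \<alpha> \<beta> n)
              - (E (\<alpha>, \<beta>, n) + 1 / of_nat N * L (\<alpha>, \<beta>, n))) \<in> O(\<lambda>N. 1 / (of_nat N)\<^sup>2))
       \<and> (\<forall>N \<alpha> \<beta> n. N \<ge> 1 \<longrightarrow> plen \<alpha> \<le> A_bound N \<longrightarrow> plen \<beta> \<le> B_bound N \<longrightarrow>
            complex_of_real (kappa_A' N \<alpha> \<beta> n)
              = E (\<alpha>, \<beta>, n) + 1 / of_nat N * L (\<alpha>, \<beta>, n)))
   \<and> (\<exists>E L Q. E \<in> alg_A \<and> L \<in> alg_A
       \<and> {E, L} \<subseteq> polys_in {\<lambda>(\<alpha>, \<beta>). p\<^sub>1 \<alpha>, \<lambda>(\<alpha>, \<beta>). p\<^sub>2 \<alpha>,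
                            \<lambda>(\<alpha>, \<beta>). p\<^sub>1 \<beta>, \<lambda>(\<alpha>, \<beta>). p\<^sub>2 \<beta>}
       \<and> Q \<in> polys_in {\<lambda>(\<alpha>, \<beta>). p\<^sub>1 \<alpha>, \<lambda>(\<alpha>, \<beta>). p\<^sub>1 \<beta>}
       \<and> (\<forall>\<alpha> \<beta>. E (\<alpha>, \<beta>) = p\<^sub>1 \<alpha> + p\<^sub>1 \<beta>)
       \<and> (\<forall>\<alpha> \<beta>. L (\<alpha>, \<beta>) = p\<^sub>2 \<alpha> + p\<^sub>2 \<beta>)
       \<and> (\<forall>\<alpha> \<beta>. (\<lambda>N. complex_of_real (kappa_A N \<alpha> \<beta>)
              - (E (\<alpha>, \<beta>) + 1 / of_nat N * L (\<alpha>, \<beta>))) \<in> O(\<lambda>N. 1 / (of_nat N)\<^sup>2))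
       \<and> (\<forall>N \<alpha> \<beta>. N \<ge> 1 \<longrightarrow> plen \<alpha> \<le> A_bound N \<longrightarrow> plen \<beta> \<le> B_bound N \<longrightarrow>
            complex_of_real (kappa_A N \<alpha> \<beta>)
              = E (\<alpha>, \<beta>) + 1 / of_nat N * L (\<alpha>, \<beta>) + 1 / (of_nat N)\<^sup>2 * Q (\<alpha>, \<beta>)))
   \<and> (\<exists>E L. E \<in> Lambda_star \<and> L \<in> Lambda_star \<and> {E, L} \<subseteq> polys_in {p\<^sub>1, p\<^sub>2}
       \<and> (\<forall>\<mu>. E \<mu> = p\<^sub>1 \<mu>) \<and> (\<forall>\<mu>. L \<mu> = p\<^sub>2 \<mu> - p\<^sub>1 \<mu>)
       \<and> (\<forall>\<mu>. (\<lambda>r. complex_of_real (kappa_B (2 * r + 1) \<mu>)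
              - (E \<mu> + 1 / of_nat (2 * r + 1) * L \<mu>)) \<in> O(\<lambda>r. 1 / (of_nat (2 * r + 1))\<^sup>2)))
   \<and> (\<exists>E L. E \<in> Lambda_star \<and> L \<in> Lambda_star \<and> {E, L} \<subseteq> polys_in {p\<^sub>1, p\<^sub>2}
       \<and> (\<forall>\<mu>. E \<mu> = p\<^sub>1 \<mu>) \<and> (\<forall>\<mu>. L \<mu> = p\<^sub>2 \<mu> + p\<^sub>1 \<mu>)
       \<and> (\<forall>\<mu>. (\<lambda>r. complex_of_real (kappa_C (2 * r) \<mu>)
              - (E \<mu> + 1 / of_nat (2 * r) * L \<mu>)) \<in> O(\<lambda>r. 1 / (of_nat (2 * r))\<^sup>2)))
   \<and> (\<exists>E L. E \<in> Lambda_star \<and> L \<in> Lambda_star \<and> {E, L} \<subseteq> polys_in {p\<^sub>1, p\<^sub>2}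
       \<and> (\<forall>\<mu>. (\<lambda>r. complex_of_real (kappa_D (2 * r) \<mu> 0 0)
              - (E \<mu> + 1 / of_nat (2 * r) * L \<mu>)) \<in> O(\<lambda>r. 1 / (of_nat (2 * r))\<^sup>2)))
   \<and> (\<exists>c>0. \<forall>\<mu> m n. \<bar>n\<bar> \<le> int m \<longrightarrow> (m, n) \<noteq> (0, 0) \<longrightarrow>
       m \<ge> 1
       \<and> (\<lambda>r. kappa_D (2 * r) \<mu> m n - c * real m * real (2 * r)) \<in> O(\<lambda>_. 1)
       \<and> \<not> convergent (\<lambda>r. kappa_D (2 * r) \<mu> m n))"
  apply (intro conjI)
  subgoal
    apply (rule exI[of _ "\<lambda>(\<alpha>, \<beta>, n). p\<^sub>1 \<alpha> + p\<^sub>1 \<beta> + (of_int n)\<^sup>2"],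
        rule exI[of _ "\<lambda>(\<alpha>, \<beta>, n). p\<^sub>2 \<alpha> + p\<^sub>2 \<beta> + 2 * of_int n * (p\<^sub>1 \<alpha> - p\<^sub>1 \<beta>)"])
    using E_in_alg_A' L_in_alg_A' polys_in_A'[OF refl] bigo_A' expansion_A'[OF _ bounds_imp_length_le]
    unfolding insert_subset prod.case by blast
  subgoal
    \<comment> \<open>The witness for Q is what remains of the subtracted square of the mean in
      \<open>kappa_A_eq\<close>.\<close>
    apply (rule exI[of _ "\<lambda>(\<alpha>, \<beta>). p\<^sub>1 \<alpha> + p\<^sub>1 \<beta>"], rule exI[of _ "\<lambda>(\<alpha>, \<beta>). p\<^sub>2 \<alpha> + p\<^sub>2 \<beta>"],
        rule exI[of _ "\<lambda>(\<alpha>, \<beta>). - (p\<^sub>1 \<alpha> - p\<^sub>1 \<beta>)\<^sup>2"])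
    using fun_tensor_Lambda_star[OF Lambda_star_power_sum Lambda_star_power_sum, of 1 1]
      fun_tensor_Lambda_star[OF Lambda_star_power_sum Lambda_star_power_sum, of 2 2]
      polys_in_A Q_polys_in bigo_A expansion_A[OF _ bounds_imp_length_le]
    unfolding insert_subset prod.case by simp
  subgoal
    using Lambda_star_power_sum[of 1] Lambda_star_diff[OF Lambda_star_power_sum Lambda_star_power_sum, of 2 1]
      polys_in_power_sums bigo_B
    by (intro exI[of _ p\<^sub>1] exI[of _ "\<lambda>\<mu>. p\<^sub>2 \<mu> - p\<^sub>1 \<mu>"]) simp
  subgoal
    using Lambda_star_power_sum[of 1] Lambda_star_add[OF Lambda_star_power_sum Lambda_star_power_sum, of 2 1]
      polys_in_power_sums bigo_C
    by (intro exI[of _ p\<^sub>1] exI[of _ "\<lambda>\<mu>. p\<^sub>2 \<mu> + p\<^sub>1 \<mu>"]) simp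
  subgoal
    using Lambda_star_power_sum[of 1] Lambda_star_diff[OF Lambda_star_power_sum Lambda_star_power_sum, of 2 1]
      polys_in_power_sums bigo_D
    by (intro exI[of _ p\<^sub>1] exI[of _ "\<lambda>\<mu>. p\<^sub>2 \<mu> - p\<^sub>1 \<mu>"]) simp
  subgoal
    \<comment> \<open>The value 1/4 is the coefficient of mN in \<open>kappa_D_eq\<close>.\<close>
    using kappa_D_unbounded by (intro exI[of _ "1 / 4 :: real"]) simp
  done

end
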